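(* For $m=5$, the injection $\phi$ from the regions of the inside-out polytope $(\Delta_{4},\mathcal{G}_5)$ to the coherent acyclic orientations of the Golomb graph $\Gamma_5$ is not surjective. In particular, there is no bijection between the coherent acyclic orientations of $\Gamma_5$ and the regions of $(\Delta_4,\mathcal{G}_5)$.
   Context: Notation: $[m]=\{1,\dots,m\}$ and $\Delta_{m-1}=\{\mathbf{z}\in\mathbb{R}^m: z_1,\dots,z_m\ge 0,\ \sum_{i=1}^m z_i=1\}$. A consecutive subset of $[m]$ is a nonempty set of the form $\{j,j+1,\dots,k\}$; it is proper if it is not equal to $[m]$. $\mathcal{G}_m$ is the arrangement of hyperplanes $\sum_{i\in U}z_i=\sum_{i\in V}z_i$, for all pairs of distinct consecutive subsets $U,V$ of $[m]$. A region of $(\Delta_{m-1},\mathcal{G}_m)$ is a connected component of $\Delta_{m-1}\setminus\bigcup_{H\in\mathcal{G}_m}H$. The Golomb graph $\Gamma_m$ is the mixed graph whose vertices are the proper consecutive subsets of $[m]$ and in which every two distinct vertices are joined by one edge: the edge is directed from $U$ to $V$ if $U\subsetneq V$, and all other edges are undirected. An orientation of $\Gamma_m$ assigns a direction to every edge. It is coherent if (a) it is consistent with the directed edges, and (b) whenever $U,V,W$ are pairwise disjoint consecutive sets such that $A=U\cup W$ and $B=V\cup W$ are also (proper) consecutive subsets, then $A\to B$ if and only if $U\to V$. It is acyclic if it has no directed cycle. The map $\phi$ sends a region $R$ to the orientation of $\Gamma_m$ in which $U\to V$ if and only if $\sum_{j\in U}z_j<\sum_{j\in V}z_j$ for all $\mathbf{z}\in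 R$ (for each pair of distinct proper consecutive subsets exactly one of the two strict inequalities holds throughout $R$). This orientation is coherent and acyclic, and $\phi$ is injective. *)

theory Defs
  imports "HOL-Analysis.Analysis"
begin

text \<open>
  Points of \<open>\<real>\<^sup>m\<close> are functions \<open>nat \<Rightarrow> real\<close> vanishing outside the index set
  \<open>{1..m}\<close>; the product topology on \<open>nat \<Rightarrow> real\<close> induces the Euclidean topology there.
\<close>

definition Rspace :: "nat \<Rightarrow> (nat \<Rightarrow> real) set" where
  "Rspace m = {z. \<forall>i. i \<notin> {1..m} \<longrightarrow> z i = 0}"

text \<open>The simplex \<open>\<Delta>\<^bsub>m-1\<^esub>\<close>, indexed here by \<open>m\<close>.\<close>

definition simplex_in :: "nat \<Rightarrow> (nat \<Rightarrow> real) set" where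
  "simplex_in m = {z \<in> Rspace m. (\<forall>i\<in>{1..m}. z i \<ge> 0) \<and> (\<Sum>i\<in>{1..m}. z i) = 1}"

definition consecutive :: "nat \<Rightarrow> nat set \<Rightarrow> bool" where
  "consecutive m U \<longleftrightarrow> (\<exists>j k. 1 \<le> j \<and> j \<le> k \<and> k \<le> m \<and> U = {j..k})"

definition proper_consecutive :: "nat \<Rightarrow> nat set \<Rightarrow> bool" where
  "proper_consecutive m U \<longleftrightarrow> consecutive m U \<and> U \<noteq> {1..m}"

definition golomb_hyperplane :: "nat \<Rightarrow> nat set \<Rightarrow> nat set \<Rightarrow> (nat \<Rightarrow> real) set" where
  "golomb_hyperplane m U V = {z \<in> Rspace m. (\<Sum>i\<in>U. z i) = (\<Sum>i\<in>V. z i)}"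

definition golomb_arrangement :: "nat \<Rightarrow> (nat \<Rightarrow> real) set set" where
  "golomb_arrangement m =
     {golomb_hyperplane m U V | U V. consecutive m U \<and> consecutive m V \<and> U \<noteq> V}"

definition regions :: "nat \<Rightarrow> (nat \<Rightarrow> real) set set" where
  "regions m = components (simplex_in m - \<Union> (golomb_arrangement m))"

text \<open>
  A directed edge from \<open>u\<close> to \<open>v\<close> is the pair \<open>(u, v)\<close>, an undirected one the set \<open>{u, v}\<close>.
\<close>

record 'v mixed_graph =
  vertices :: "'v set"
  directed_edges :: "('v \<times> 'v) set"
  undirected_edges :: "'v set set"

definition adjacent :: "'v mixed_graph \<Rightarrow> 'v \<Rightarrow> 'v \<Rightarrow> bool" where
  "adjacent G u v \<longleftrightarrow>
     (u, v) \<in> directed_edges G \<or> (v, u) \<in> directed_edges G \<or> {u, v} \<in> undirected_edges G"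

text \<open>
  An orientation is given by its set of arcs. It need not respect the given directions
  of the directed edges; that is part of coherence.
\<close>

definition orientation :: "'v mixed_graph \<Rightarrow> ('v \<times> 'v) set \<Rightarrow> bool" where
  "orientation G D \<longleftrightarrow>
     (\<forall>u v. (u, v) \<in> D \<longrightarrow> adjacent G u v) \<and>
     (\<forall>u v. adjacent G u v \<longrightarrow> ((u, v) \<in> D \<longleftrightarrow> (v, u) \<notin> D))"

definition golomb_graph :: "nat \<Rightarrow> nat set mixed_graph" where
  "golomb_graph m =
     \<lparr> vertices = {U. proper_consecutive m U},
       directed_edges = {(U, V). proper_consecutive m U \<and> proper_consecutive m V \<and> U \<subset> V},
       undirected_edges = {{U, V} | U V. proper_consecutive m U \<and> proper_consecutive m V \<and>
                             U \<noteq> V \<and> \<not> U \<subset> V \<and> \<not> V \<subset> U} \<rparr>"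

definition coherent :: "nat \<Rightarrow> (nat set \<times> nat set) set \<Rightarrow> bool" where
  "coherent m D \<longleftrightarrow>
     directed_edges (golomb_graph m) \<subseteq> D \<and>
     (\<forall>U V W. consecutive m U \<and> consecutive m V \<and> consecutive m W \<and>
        U \<inter> V = {} \<and> U \<inter> W = {} \<and> V \<inter> W = {} \<and>
        proper_consecutive m (U \<union> W) \<and> proper_consecutive m (V \<union> W) \<longrightarrow>
        ((U \<union> W, V \<union> W) \<in> D \<longleftrightarrow> (U, V) \<in> D))"

definition coherent_acyclic_orientations :: "nat \<Rightarrow> (nat set \<times> nat set) set set" where
  "coherent_acyclic_orientations m =
     {D. orientation (golomb_graph m) D \<and> coherent m D \<and> acyclic D}"

definition region_orientation :: "nat \<Rightarrow> (nat \<Rightarrow> real) set \<Rightarrow> (nat set \<times> nat set) set" where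
  "region_orientation m R =
     {(U, V). U \<in> vertices (golomb_graph m) \<and> V \<in> vertices (golomb_graph m) \<and> U \<noteq> V \<and>
        (\<forall>z\<in>R. (\<Sum>j\<in>U. z j) < (\<Sum>j\<in>V. z j))}"

end

theory Submission
  imports Defs
begin

text \<open>
  Each strict comparison of two consecutive sums is constant on a region by connectedness, and the
  comparisons determine the region by convexity.

  For the failure of surjectivity, the inequalities \<open>z\<^sub>1 < z\<^sub>5\<close>, \<open>z\<^sub>2 + z\<^sub>3 < z\<^sub>4\<close> and
  \<open>z\<^sub>4 + z\<^sub>5 < z\<^sub>1 + z\<^sub>2 + z\<^sub>3\<close> are contradictory, since their left and right sides have the same
  total. The coherence condition, however, never relates \<open>{4,5}\<close> and \<open>{1,2,3}\<close> to another pair,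
  because their union is \<open>{1..5}\<close> and no element is left over for \<open>W\<close>. So one takes weights that
  satisfy the first two inequalities and for which \<open>{1,2,3}\<close> and \<open>{4,5}\<close> have adjacent sums, and
  reverses this single arc.
\<close>

section \<open>Orientations induced by a ranking\<close>

text \<open>The codomain is any linear order, so that both the real sums at a point of a region and
  the natural-valued \<open>twisted_rank\<close> are instances.\<close>

definition ranking_orientation :: "nat \<Rightarrow> (nat set \<Rightarrow> 'a::linorder) \<Rightarrow> (nat set \<times> nat set) set" where
  "ranking_orientation m f =
     {(U, V). proper_consecutive m U \<and> proper_consecutive m V \<and> f U < f V}"

lemma consecutive_subset: "consecutive m U \<Longrightarrow> U \<subseteq> {1..m}"
  by (auto simp: consecutive_def)

lemma consecutive_nonempty: "consecutive m U \<Longrightarrow> U \<noteq> {}"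
  by (auto simp: consecutive_def)

lemma consecutive_finite: "consecutive m U \<Longrightarrow> finite U"
  by (auto simp: consecutive_def)

text \<open>Nested pairs carry a directed edge and incomparable pairs an undirected one, so the
  underlying graph is complete.\<close>

lemma adjacent_golomb_graph_iff:
  "adjacent (golomb_graph m) U V \<longleftrightarrow>
     proper_consecutive m U \<and> proper_consecutive m V \<and> U \<noteq> V"
  by (auto simp: adjacent_def golomb_graph_def doubleton_eq_iff)

lemma acyclic_ranking_orientation: "acyclic (ranking_orientation m f)"
proof -
  have "trans (ranking_orientation m f)"
    by (rule transI) (auto simp: ranking_orientation_def)
  then have "(ranking_orientation m f)\<^sup>+ = ranking_orientation m f"
    by (rule trancl_id)
  then show ?thesis
    by (auto simp: acyclic_def ranking_orientation_def)
qed

lemma orientation_ranking_orientation: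
  assumes "inj_on f {U. proper_consecutive m U}"
  shows "orientation (golomb_graph m) (ranking_orientation m f)"
  unfolding orientation_def adjacent_golomb_graph_iff
proof (intro conjI allI impI)
  fix U V assume "proper_consecutive m U \<and> proper_consecutive m V \<and> U \<noteq> V"
  then have "f U \<noteq> f V" "proper_consecutive m U" "proper_consecutive m V"
    using assms by (auto simp: inj_on_def)
  then show "(U, V) \<in> ranking_orientation m f \<longleftrightarrow> (V, U) \<notin> ranking_orientation m f"
    by (auto simp: ranking_orientation_def)
qed (auto simp: ranking_orientation_def)

text \<open>For a rank given by sums, \<open>coh\<close> is cancellation of the sum over
  \<open>W\<close>; the abstract form also covers a rank that is not additive.\<close>

lemma coherent_ranking_orientation:
  assumes mono: "\<And>U V. proper_consecutive m U \<Longrightarrow> proper_consecutive m V \<Longrightarrow> U \<subset> V \<Longrightarrow> f U < f V"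
    and coh: "\<And>U V W. consecutive m U \<Longrightarrow> consecutive m V \<Longrightarrow> consecutive m W \<Longrightarrow>
        U \<inter> V = {} \<Longrightarrow> U \<inter> W = {} \<Longrightarrow> V \<inter> W = {} \<Longrightarrow>
        proper_consecutive m (U \<union> W) \<Longrightarrow> proper_consecutive m (V \<union> W) \<Longrightarrow>
        f (U \<union> W) < f (V \<union> W) \<longleftrightarrow> f U < f V"
  shows "coherent m (ranking_orientation m f)"
  unfolding coherent_def
proof (intro conjI allI impI; (elim conjE)?)
  show "directed_edges (golomb_graph m) \<subseteq> ranking_orientation m f"
    by (auto simp: golomb_graph_def ranking_orientation_def intro: mono)
  fix U V W
  assume *: "consecutive m U" "consecutive m V" "consecutive m W"
    "U \<inter> V = {}" "U \<inter> W = {}" "V \<inter> W = {}"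
    "proper_consecutive m (U \<union> W)" "proper_consecutive m (V \<union> W)"
  \<comment> \<open>\<open>U\<close> and \<open>V\<close> are disjoint and nonempty inside
    \<open>{1..m}\<close>, so each misses an element and is a vertex.\<close>
  have "proper_consecutive m U" "proper_consecutive m V"
    using * consecutive_subset[of m U] consecutive_subset[of m V] consecutive_nonempty[of m U]
      consecutive_nonempty[of m V]
    unfolding proper_consecutive_def by blast+
  then show "(U \<union> W, V \<union> W) \<in> ranking_orientation m f \<longleftrightarrow> (U, V) \<in> ranking_orientation m f"
    using coh[OF *] * by (simp add: ranking_orientation_def)
qed

text \<open>Finiteness turns failure of surjectivity into a strict inequality of cardinalities,
  which excludes every bijection.\<close>

lemma finite_coherent_acyclic_orientations: "finite (coherent_acyclic_orientations m)"
proof (rule finite_subset)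
  show "coherent_acyclic_orientations m \<subseteq> Pow (Pow {1..m} \<times> Pow {1..m})"
  proof (intro subsetI PowI, clarify)
    fix D U V assume "D \<in> coherent_acyclic_orientations m" "(U, V) \<in> D"
    then have "adjacent (golomb_graph m) U V"
      unfolding coherent_acyclic_orientations_def orientation_def by blast
    then show "U \<in> Pow {1..m} \<and> V \<in> Pow {1..m}"
      unfolding adjacent_golomb_graph_iff proper_consecutive_def using consecutive_subset by blast
  qed
qed simp

section \<open>Orientations of regions\<close>

definition generic_points :: "nat \<Rightarrow> (nat \<Rightarrow> real) set" where
  "generic_points m = simplex_in m - \<Union> (golomb_arrangement m)"

lemma generic_points_iff:
  "z \<in> generic_points m \<longleftrightarrow> z \<in> simplex_in m \<and>
     (\<forall>U V. consecutive m U \<longrightarrow> consecutive m V \<longrightarrow> U \<noteq> V \<longrightarrow> sum z U \<noteq> sum z V)"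
  by (auto simp: generic_points_def simplex_in_def golomb_arrangement_def golomb_hyperplane_def)

text \<open>Nonnegative coordinates give the weak inequality; equality would put \<open>z\<close> on
  a hyperplane of the arrangement.\<close>

lemma sum_less_if_psubset:
  assumes z: "z \<in> generic_points m" and U: "consecutive m U" and V: "consecutive m V" and "U \<subset> V"
  shows "sum z U < sum z V"
proof -
  have "sum z U \<le> sum z V"
    using z consecutive_subset[OF V] \<open>U \<subset> V\<close>
    by (intro sum_mono2 consecutive_finite[OF V]) (auto simp: generic_points_iff simplex_in_def)
  moreover have "sum z U \<noteq> sum z V"
    using z U V \<open>U \<subset> V\<close> by (auto simp: generic_points_iff)
  ultimately show ?thesis by simp
qed

lemma regions_subset: "R \<in> regions m \<Longrightarrow> R \<subseteq> generic_points m"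
  unfolding regions_def generic_points_def by (rule in_components_subset)

text \<open>Intermediate value argument: a change of sign of the difference of the two sums on a
  connected set forces a zero, which is a point on a hyperplane.\<close>

lemma sum_less_on_region:
  assumes R: "R \<in> regions m" and UV: "consecutive m U" "consecutive m V"
    and "z \<in> R" "z' \<in> R" and less: "sum z U < sum z V"
  shows "sum z' U < sum z' V"
proof (rule ccontr)
  let ?g = "\<lambda>z::nat \<Rightarrow> real. sum z V - sum z U"
  assume "\<not> sum z' U < sum z' V"
  have "continuous_on R ?g"
    by (intro continuous_intros continuous_on_subset[OF continuous_on_product_coordinates]) auto
  moreover have "connected R"
    using R unfolding regions_def by (rule in_components_connected)
  ultimately have "connected (?g ` R)"
    by (rule connected_continuous_image)
  moreover have "?g z' \<in> ?g ` R" "?g z \<in> ?g ` R" "?g z' \<le> 0" "0 \<le> ?g z"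
    using assms \<open>\<not> sum z' U < sum z' V\<close> by auto
  ultimately have "0 \<in> ?g ` R"
    unfolding connected_iff_interval by blast
  then obtain y where "y \<in> R" "sum y U = sum y V" by auto
  moreover have "U \<noteq> V" using less by auto
  ultimately show False
    using regions_subset[OF R] UV unfolding generic_points_iff subset_iff by blast
qed

lemma region_orientation_eq:
  assumes R: "R \<in> regions m" and z: "z \<in> R"
  shows "region_orientation m R = ranking_orientation m (sum z)"
proof -
  have "(U \<noteq> V \<and> (\<forall>y\<in>R. sum y U < sum y V)) \<longleftrightarrow> sum z U < sum z V"
    if "proper_consecutive m U" "proper_consecutive m V" for U V
    using that sum_less_on_region[OF R _ _ z] z unfolding proper_consecutive_def
    by (metis less_irrefl)
  then show ?thesis
    unfolding region_orientation_def ranking_orientation_def golomb_graph_def by auto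
qed

lemma ranking_orientation_sum_in_coherent:
  assumes z: "z \<in> generic_points m"
  shows "ranking_orientation m (sum z) \<in> coherent_acyclic_orientations m"
proof -
  have "orientation (golomb_graph m) (ranking_orientation m (sum z))"
    using z by (intro orientation_ranking_orientation inj_onI)
      (auto simp: generic_points_iff proper_consecutive_def)
  moreover have "coherent m (ranking_orientation m (sum z))"
    using z by (intro coherent_ranking_orientation)
      (auto simp: proper_consecutive_def sum_less_if_psubset sum.union_disjoint consecutive_finite)
  ultimately show ?thesis
    by (simp add: coherent_acyclic_orientations_def acyclic_ranking_orientation)
qed

lemma region_orientation_in_coherent:
  assumes R: "R \<in> regions m"
  shows "region_orientation m R \<in> coherent_acyclic_orientations m"
proof -
  obtain z where "z \<in> R"
    using R in_components_nonempty unfolding regions_def by blast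
  then show ?thesis
    using region_orientation_eq[OF R] ranking_orientation_sum_in_coherent regions_subset[OF R]
    by auto
qed

text \<open>The orientation compares only proper sets, while the arrangement also involves
  \<open>{1..m}\<close>. Comparisons with \<open>{1..m}\<close> are the same at all generic points,
  because they follow from inclusion.\<close>

lemma sum_less_transfer:
  assumes z: "z \<in> generic_points m" and z': "z' \<in> generic_points m"
    and eq: "ranking_orientation m (sum z) = ranking_orientation m (sum z')"
    and UV: "consecutive m U" "consecutive m V" and less: "sum z U < sum z V"
  shows "sum z' U < sum z' V"
proof (cases "U = {1..m} \<or> V = {1..m}")
  case True
  have "U \<noteq> V" "\<not> V \<subset> U"
    using less sum_less_if_psubset[OF z UV(2,1)] by auto
  then have "U \<subset> V"
    using True UV consecutive_subset by blast
  then show ?thesis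
    by (rule sum_less_if_psubset[OF z' UV])
next
  case False
  then have "(U, V) \<in> ranking_orientation m (sum z)"
    using UV less by (simp add: ranking_orientation_def proper_consecutive_def)
  then show ?thesis
    unfolding eq by (simp add: ranking_orientation_def)
qed

text \<open>Every strict comparison that holds at both endpoints persists along the segment, so the
  segment meets no hyperplane.\<close>

lemma convex_combination_generic:
  assumes z: "z \<in> generic_points m" and z': "z' \<in> generic_points m"
    and eq: "ranking_orientation m (sum z) = ranking_orientation m (sum z')"
    and t: "0 \<le> t" "t \<le> 1"
  shows "(\<lambda>i. (1 - t) * z i + t * z' i) \<in> generic_points m"
proof -
  define y where "y = (\<lambda>i. (1 - t) * z i + t * z' i)"
  have sum_y: "sum y A = (1 - t) * sum z A + t * sum z' A" for A
    by (simp add: y_def sum.distrib sum_distrib_left)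
  have less_y: "sum y U < sum y V"
    if "consecutive m U" "consecutive m V" "sum z U < sum z V" for U V
  \<comment> \<open>For \<open>t > 0\<close> the strictness comes from the \<open>z'\<close> term
    and the \<open>z\<close> term contributes a weak inequality; at \<open>t = 0\<close> only
    \<open>z\<close> remains.\<close>
  proof (cases "t = 0")
    case True
    then show ?thesis using that by (simp add: sum_y)
  next
    case False
    have "sum z' U < sum z' V"
      using sum_less_transfer[OF z z' eq] that by blast
    then have "t * sum z' U < t * sum z' V" "(1 - t) * sum z U \<le> (1 - t) * sum z V"
      using False t that by (auto intro: mult_left_mono)
    then show ?thesis by (simp add: sum_y)
  qed
  have simplex: "z \<in> simplex_in m" "z' \<in> simplex_in m"
    using z z' by (simp_all add: generic_points_iff)
  then have "sum y {1..m} = 1"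
    unfolding sum_y simplex_in_def by simp
  with simplex have "y \<in> simplex_in m"
    using t by (simp add: simplex_in_def Rspace_def) (simp add: y_def)
  moreover have "sum y U \<noteq> sum y V" if "consecutive m U" "consecutive m V" "U \<noteq> V" for U V
  proof -
    have "sum z U \<noteq> sum z V"
      using z that by (auto simp: generic_points_iff)
    then show ?thesis
      using less_y[of U V] less_y[of V U] that by (cases "sum z U" "sum z V" rule: linorder_cases) auto
  qed
  ultimately have "y \<in> generic_points m"
    unfolding generic_points_iff by blast
  then show ?thesis
    unfolding y_def .
qed

text \<open>Points of two regions with equal orientations are joined by a segment of generic points.
  Being connected, it lies in both components, which therefore coincide.\<close>

lemma inj_on_region_orientation: "inj_on (region_orientation m) (regions m)"
proof (rule inj_onI)
  fix R R' assume R: "R \<in> regions m" and R': "R' \<in> regions m"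
    and eq: "region_orientation m R = region_orientation m R'"
  obtain z z' where zR: "z \<in> R" "z' \<in> R'"
    using R R' in_components_nonempty unfolding regions_def by blast
  then have gen: "z \<in> generic_points m" "z' \<in> generic_points m"
    using R R' regions_subset by auto
  define p where "p = (\<lambda>t i. (1 - t) * z i + t * z' i)"
  have "ranking_orientation m (sum z) = ranking_orientation m (sum z')"
    using eq zR region_orientation_eq R R' by metis
  then have "p ` {0..1} \<subseteq> generic_points m"
    using convex_combination_generic[OF gen] by (auto simp: p_def)
  moreover have "connected (p ` {0..1})"
    unfolding p_def
    by (intro connected_continuous_image continuous_on_coordinatewise_then_product
        continuous_intros) auto
  moreover have "p 0 = z" "p 1 = z'"
    by (auto simp: p_def)
  then have "z \<in> p ` {0..1}" "z' \<in> p ` {0..1}"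
    by force+
  ultimately have "p ` {0..1} \<subseteq> R" "p ` {0..1} \<subseteq> R'"
    using components_maximal R R' zR unfolding regions_def generic_points_def by blast+
  then have "R \<inter> R' \<noteq> {}"
    using \<open>z \<in> p ` {0..1}\<close> by auto
  then show "R = R'"
    using R R' components_nonoverlap unfolding regions_def by metis
qed

section \<open>A coherent acyclic orientation without a region\<close>

lemma interval_enumerations:
  "{1..1} = {1::nat}" "{1..2} = {1,2::nat}" "{1..3} = {1,2,3::nat}" "{1..4} = {1,2,3,4::nat}"
  "{2..2} = {2::nat}" "{2..3} = {2,3::nat}" "{2..4} = {2,3,4::nat}" "{2..5} = {2,3,4,5::nat}"
  "{3..3} = {3::nat}" "{3..4} = {3,4::nat}" "{3..5} = {3,4,5::nat}"
  "{4..4} = {4::nat}" "{4..5} = {4,5::nat}" "{5..5} = {5::nat}"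
  by auto

lemma proper_consecutive_5_cases:
  assumes "proper_consecutive 5 U"
  shows "U \<in> {{1}, {2}, {3}, {4}, {5}, {1,2}, {2,3}, {3,4}, {4,5}, {1,2,3}, {2,3,4}, {3,4,5},
    {1,2,3,4}, {2,3,4,5}}"
proof -
  obtain j k where jk: "1 \<le> j" "j \<le> k" "k \<le> 5" and U: "U = {j..k}" and "U \<noteq> {1..5}"
    using assms by (auto simp: proper_consecutive_def consecutive_def)
  from jk have "j = 1 \<or> j = 2 \<or> j = 3 \<or> j = 4 \<or> j = 5" "k = 1 \<or> k = 2 \<or> k = 3 \<or> k = 4 \<or> k = 5"
    by linarith+
  with jk U \<open>U \<noteq> {1..5}\<close> show ?thesis
    \<comment> \<open>Of the 25 cases, those with \<open>k < j\<close> contradict \<open>jk\<close>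
      and \<open>(1, 5)\<close> contradicts properness.\<close>
    by (elim disjE) (simp_all del: One_nat_def add: interval_enumerations)
qed

text \<open>The choice satisfies \<open>2 < 4\<close> and \<open>1 + 6 < 8\<close>, and the 14
  proper consecutive subsets have pairwise distinct sums.\<close>

definition weight :: "nat \<Rightarrow> nat" where
  "weight = (\<lambda>_. 0)(1 := 2, 2 := 1, 3 := 6, 4 := 8, 5 := 4)"

text \<open>
  The sums of \<open>{1,2,3}\<close> and \<open>{4,5}\<close> are \<open>9\<close> and \<open>12\<close>, and no proper consecutive subset has a sum
  in between or equal to \<open>13\<close>.
\<close>

definition twisted_rank :: "nat set \<Rightarrow> nat" where
  "twisted_rank U = (if U = {1,2,3} then 13 else sum weight U)"

lemma twisted_rank_simps:
  "twisted_rank {1} = 2" "twisted_rank {2} = 1" "twisted_rank {3} = 6" "twisted_rank {4} = 8"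
  "twisted_rank {5} = 4" "twisted_rank {1,2} = 3" "twisted_rank {2,3} = 7"
  "twisted_rank {3,4} = 14" "twisted_rank {4,5} = 12" "twisted_rank {1,2,3} = 13"
  "twisted_rank {2,3,4} = 15" "twisted_rank {3,4,5} = 18" "twisted_rank {1,2,3,4} = 17"
  "twisted_rank {2,3,4,5} = 19"
  by (simp_all add: twisted_rank_def weight_def set_eq_subset)

lemma inj_on_twisted_rank: "inj_on twisted_rank {U. proper_consecutive 5 U}"
proof (rule inj_onI, unfold mem_Collect_eq)
  fix U V assume UV: "proper_consecutive 5 U" "proper_consecutive 5 V"
    and "twisted_rank U = twisted_rank V"
  then show "U = V"
    using UV[THEN proper_consecutive_5_cases]
    by (elim insertE emptyE; hypsubst) (simp_all add: twisted_rank_simps del: One_nat_def)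
qed

text \<open>Raising \<open>{1,2,3}\<close> from 9 to 13 passes only the value 12 of
  \<open>{4,5}\<close>. The last hypothesis excludes this pair, which is disjoint with union
  \<open>{1..5}\<close>.\<close>

lemma twisted_rank_less_iff:
  assumes U: "proper_consecutive 5 U" and V: "proper_consecutive 5 V"
    and "U \<inter> V \<noteq> {} \<or> U \<union> V \<noteq> {1..5}"
  shows "twisted_rank U < twisted_rank V \<longleftrightarrow> sum weight U < sum weight V"
proof -
  have *: "(twisted_rank {1,2,3} < twisted_rank A \<longleftrightarrow> sum weight {1,2,3} < sum weight A) \<and>
           (twisted_rank A < twisted_rank {1,2,3} \<longleftrightarrow> sum weight A < sum weight {1,2,3})"
    if "proper_consecutive 5 A" "A \<noteq> {4,5}" for A
    using proper_consecutive_5_cases[OF that(1)] that(2)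
    by (elim insertE emptyE; hypsubst) (simp_all add: twisted_rank_def weight_def set_eq_subset)
  have "{1..5} = {1,2,3,4,5::nat}"
    by auto
  then have "\<not> (U = {1,2,3} \<and> V = {4,5})" "\<not> (U = {4,5} \<and> V = {1,2,3})"
    using assms(3) by auto
  then consider "U \<noteq> {1,2,3}" "V \<noteq> {1,2,3}" | "U = {1,2,3}" "V \<noteq> {4,5}"
    | "V = {1,2,3}" "U \<noteq> {4,5}"
    by blast
  then show ?thesis
  proof cases
    case 1
    then show ?thesis by (simp add: twisted_rank_def)
  qed (use * U V in blast)+
qed

lemma twisted_orientation_coherent_acyclic:
  "ranking_orientation 5 twisted_rank \<in> coherent_acyclic_orientations 5"
proof -
  have "coherent 5 (ranking_orientation 5 twisted_rank)"
  proof (rule coherent_ranking_orientation)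
    fix U V assume U: "proper_consecutive 5 U" and V: "proper_consecutive 5 V" and "U \<subset> V"
    \<comment> \<open>Nested sets intersect, so their twisted comparison is that of the weights, and
      all weights on \<open>{1..5}\<close> are positive.\<close>
    have "U \<inter> V \<noteq> {}"
      using U \<open>U \<subset> V\<close> consecutive_nonempty by (auto simp: proper_consecutive_def)
    moreover obtain x where "x \<in> V" "x \<notin> U"
      using \<open>U \<subset> V\<close> by auto
    moreover have "V \<subseteq> {1..5}" "finite V"
      using V consecutive_subset consecutive_finite by (auto simp: proper_consecutive_def)
    moreover from this \<open>x \<in> V\<close> have "x \<in> {1,2,3,4,5}"
      by auto
    then have "0 < weight x"
      by (auto simp: weight_def)
    ultimately show "twisted_rank U < twisted_rank V"
      using twisted_rank_less_iff[OF U V] \<open>U \<subset> V\<close> sum_strict_mono2[of V U x weight] by auto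
  next
    fix U V W
    assume *: "consecutive 5 U" "consecutive 5 V" "consecutive 5 W"
      and disj: "U \<inter> V = {}" "U \<inter> W = {}" "V \<inter> W = {}"
      and UVW: "proper_consecutive 5 (U \<union> W)" "proper_consecutive 5 (V \<union> W)"
    \<comment> \<open>A point of \<open>W\<close> lies outside \<open>U \<union> V\<close> and in
      both \<open>U \<union> W\<close> and \<open>V \<union> W\<close>. Hence neither pair is the
      reversed one, and both comparisons reduce to additive weights.\<close>
    obtain x where x: "x \<in> W"
      using * consecutive_nonempty by auto
    then have "x \<in> {1..5}"
      using * consecutive_subset by blast
    with x disj have "U \<union> V \<noteq> {1..5}" "U \<noteq> {1..5}" "V \<noteq> {1..5}"
      by blast+
    then have "twisted_rank U < twisted_rank V \<longleftrightarrow> sum weight U < sum weight V"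
      using * by (intro twisted_rank_less_iff) (auto simp: proper_consecutive_def)
    moreover have "twisted_rank (U \<union> W) < twisted_rank (V \<union> W)
        \<longleftrightarrow> sum weight (U \<union> W) < sum weight (V \<union> W)"
      using UVW x by (intro twisted_rank_less_iff) auto
    ultimately show "twisted_rank (U \<union> W) < twisted_rank (V \<union> W) \<longleftrightarrow> twisted_rank U < twisted_rank V"
      using * disj by (simp add: sum.union_disjoint consecutive_finite)
  qed
  then show ?thesis
    by (simp add: coherent_acyclic_orientations_def acyclic_ranking_orientation
        orientation_ranking_orientation inj_on_twisted_rank)
qed

text \<open>The three contradictory inequalities are arcs of the twisted orientation, with ranks
  \<open>2 < 4\<close>, \<open>7 < 8\<close> and \<open>12 < 13\<close>. Adding them refutes every
  real \<open>z\<close>, whether or not it lies in the simplex.\<close>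

lemma twisted_orientation_not_realizable:
  "ranking_orientation 5 twisted_rank \<noteq> ranking_orientation 5 (sum (z :: nat \<Rightarrow> real))"
proof
  assume eq: "ranking_orientation 5 twisted_rank = ranking_orientation 5 (sum z)"
  have "proper_consecutive 5 {j..k}" if "1 \<le> j" "j \<le> k" "k \<le> 5" "(j, k) \<noteq> (1, 5)" for j k
    using that by (auto simp: proper_consecutive_def consecutive_def)
  from this[of 1 1] this[of 4 4] this[of 5 5] this[of 2 3] this[of 4 5] this[of 1 3]
  have "proper_consecutive 5 {1}" "proper_consecutive 5 {4}" "proper_consecutive 5 {5}"
    "proper_consecutive 5 {2,3}" "proper_consecutive 5 {4,5}" "proper_consecutive 5 {1,2,3}"
    unfolding interval_enumerations by simp_all
  then have "({1}, {5}) \<in> ranking_orientation 5 (sum z)"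
    "({2,3}, {4}) \<in> ranking_orientation 5 (sum z)"
    "({4,5}, {1,2,3}) \<in> ranking_orientation 5 (sum z)"
    unfolding eq[symmetric]
    by (simp_all add: ranking_orientation_def twisted_rank_def weight_def set_eq_subset)
  then show False
    by (simp add: ranking_orientation_def)
qed

theorem proposition4p2:
  shows "region_orientation 5 ` regions 5 \<subseteq> coherent_acyclic_orientations 5
    \<and> inj_on (region_orientation 5) (regions 5)
    \<and> region_orientation 5 ` regions 5 \<noteq> coherent_acyclic_orientations 5
    \<and> \<not> (\<exists>f. bij_betw f (coherent_acyclic_orientations 5) (regions 5))"
proof -
  let ?image = "region_orientation 5 ` regions 5"
  have sub: "?image \<subseteq> coherent_acyclic_orientations 5"
    using region_orientation_in_coherent by auto
  have "ranking_orientation 5 twisted_rank \<noteq> region_orientation 5 R" if R: "R \<in> regions 5" for R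
  proof -
    obtain z where "z \<in> R"
      using R in_components_nonempty unfolding regions_def by blast
    then show ?thesis
      using region_orientation_eq[OF R] twisted_orientation_not_realizable by simp
  qed
  then have neq: "?image \<noteq> coherent_acyclic_orientations 5"
    using twisted_orientation_coherent_acyclic by blast
  \<comment> \<open>By injectivity the regions are as many as their images, which form a proper
    subset of a finite set.\<close>
  have "card (regions 5) = card ?image"
    by (simp add: card_image inj_on_region_orientation)
  also have "\<dots> < card (coherent_acyclic_orientations 5)"
    using sub neq by (intro psubset_card_mono finite_coherent_acyclic_orientations) auto
  finally have "\<nexists>f. bij_betw f (coherent_acyclic_orientations 5) (regions 5)"
    using bij_betw_same_card by (metis less_irrefl)
  with sub neq show ?thesis
    using inj_on_region_orientation by blast
qed

end
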